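(* Let ${\rm D}$ be an atomic integral domain that contains $\mathbb{N}$. Let ${\rm U}$ denote the set of units of ${\rm D}$. Assume there exists an integer $n\ge 2$ such that the equation $$u_xX^n+u_yY^n=u_zZ^n$$ has no solution with $u_x,u_y,u_z\in {\rm U}$ and $X,Y,Z\in {\rm D}-\{0\}$. Then ${\rm D}$ has an infinite number of irreducibles (up to units).
   Context: $\mathbb{N}=\{0,1,2,\ldots\}$. A unit of an integral domain ${\rm D}$ is $u\in{\rm D}$ such that $uv=1$ for some $v\in{\rm D}$. An irreducible is a non-unit $p$ such that whenever $p=ab$, $a$ or $b$ is a unit. Two irreducibles $p,q$ are equivalent if $p=uq$ for some unit $u$; "${\rm D}$ has an infinite number of irreducibles (up to units)" means there are infinitely many equivalence classes. ${\rm D}$ is atomic if every nonzero non-unit element can be written (not necessarily uniquely) as a product $p_1^{x_1}\cdots p_m^{x_m}$ of irreducibles. *)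

theory Defs
  imports "HOL-Computational_Algebra.Factorial_Ring"
begin

definition unit_set :: "'a::idom set" where
  "unit_set = {u. u dvd 1}"

lemma unit_set_iff: "u \<in> unit_set \<longleftrightarrow> (\<exists>v. u * v = 1)"
  unfolding unit_set_def dvd_def mem_Collect_eq by metis

text \<open>The library's \<^const>\<open>irreducible\<close> excludes zero explicitly; in an integral domain
  this is implied by the other two clauses, since \<^term>\<open>0 = 0 * (0::'a::idom)\<close>.\<close>

lemma irreducible_iff_units:
  "irreducible (p::'a::idom) \<longleftrightarrow>
     p \<notin> unit_set \<and> (\<forall>a b. p = a * b \<longrightarrow> a \<in> unit_set \<or> b \<in> unit_set)"
proof (cases "p = 0")
  case True
  have "p = 0 * 0" using True by simp
  moreover have "(0::'a) \<notin> unit_set" by (simp add: unit_set_def)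
  moreover have "\<not> irreducible p" using True by simp
  ultimately show ?thesis by blast
qed (auto simp: irreducible_def unit_set_def)

text \<open>A multiset of irreducibles encodes the product $p_1^{x_1} \cdots p_m^{x_m}$, the
  multiplicities being the exponents.\<close>

definition atomic_domain :: "'a::idom itself \<Rightarrow> bool" where
  "atomic_domain _ \<longleftrightarrow>
     (\<forall>x::'a. x \<noteq> 0 \<and> x \<notin> unit_set \<longrightarrow>
        (\<exists>P. (\<forall>p\<in>#P. irreducible p) \<and> x = prod_mset P))"

definition irreducible_equiv :: "('a::idom \<times> 'a) set" where
  "irreducible_equiv =
     {(p, q). irreducible p \<and> irreducible q \<and> (\<exists>u\<in>unit_set. p = u * q)}"

lemma equiv_irreducible_equiv:
  "equiv {p::'a::idom. irreducible p} irreducible_equiv"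
proof (rule equivI)
  show "irreducible_equiv \<subseteq> {p::'a. irreducible p} \<times> {p. irreducible p}"
    by (auto simp: irreducible_equiv_def)
  show "refl_on {p::'a. irreducible p} irreducible_equiv"
  proof (rule refl_onI)
    fix p :: 'a
    assume "p \<in> {p. irreducible p}"
    moreover have "p = 1 * p" "(1::'a) \<in> unit_set" by (simp_all add: unit_set_def)
    ultimately show "(p, p) \<in> irreducible_equiv" unfolding irreducible_equiv_def by blast
  qed
  show "sym (irreducible_equiv :: ('a \<times> 'a) set)"
  proof (rule symI)
    fix p q :: 'a
    assume "(p, q) \<in> irreducible_equiv"
    then obtain u where irr: "irreducible p" "irreducible q" and u: "u \<in> unit_set" "p = u * q"
      by (auto simp: irreducible_equiv_def)
    obtain v where "u * v = 1" using u(1) unit_set_iff by blast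
    have "v * u = 1" using \<open>u * v = 1\<close> by (simp add: mult.commute)
    hence "v \<in> unit_set" "q = v * p"
      unfolding unit_set_iff u(2) mult.assoc[symmetric] by (blast, simp)
    thus "(q, p) \<in> irreducible_equiv" using irr unfolding irreducible_equiv_def by blast
  qed
  show "trans (irreducible_equiv :: ('a \<times> 'a) set)"
  proof (rule transI)
    fix p q r :: 'a
    assume "(p, q) \<in> irreducible_equiv" "(q, r) \<in> irreducible_equiv"
    then obtain u v where irr: "irreducible p" "irreducible r"
      and uv: "u dvd 1" "v dvd 1" "p = (u * v) * r"
      by (auto simp: irreducible_equiv_def unit_set_def mult.assoc)
    have "u * v dvd 1" using mult_dvd_mono[OF uv(1,2)] by simp
    thus "(p, r) \<in> irreducible_equiv"
      using irr uv(3) unfolding irreducible_equiv_def unit_set_def by blast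
  qed
qed

end

theory Submission
  imports Defs "HOL-Library.Ramsey"
begin

text \<open>Suppose there are only finitely many irreducibles up to units. Reducing the exponents of a
  factorization modulo \<open>n\<close> writes every nonzero element as \<open>u * c * w ^ n\<close> with \<open>u\<close> a unit and \<open>c\<close>
  from a finite set \<open>C\<close>. Colour the positive integers by their component \<open>c\<close>. By Schur's theorem
  there are \<open>x\<close>, \<open>y\<close> and \<open>x + y\<close> of the same colour, and cancelling \<open>c\<close> gives a forbidden solution.\<close>

text \<open>Ramsey's theorem for pairs of naturals: colour \<open>{p, q}\<close> with
  \<open>p < q\<close> by the colour of \<open>q - p\<close>. Any three elements
  \<open>a < b < c\<close> of an infinite homogeneous set give differences \<open>b - a\<close>,
  \<open>c - b\<close> and their sum \<open>c - a\<close>, all of one colour.\<close>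

lemma Schur:
  fixes f :: "nat \<Rightarrow> 'c"
  assumes fin: "finite (f ` {0<..})"
  obtains x y where "x > 0" "y > 0" "f x = f y" "f (x + y) = f x"
proof -
  \<comment> \<open>\<open>Ramsey2\<close> expects colours that are naturals below a bound, so
    \<open>g\<close> numbers the finitely many colours. Its injectivity on them translates equal
    numbers back into equal colours at the end.\<close>
  obtain g :: "'c \<Rightarrow> nat" and s where g: "g ` (f ` {0<..}) = {i. i < s}" "inj_on g (f ` {0<..})"
    using finite_imp_inj_to_nat_seg[OF fin] by blast
  \<comment> \<open>\<open>Max\<close> and \<open>Min\<close> recover the difference from an
    unordered pair.\<close>
  define h where "h X = g (f (Max X - Min X))" for X :: "nat set"
  have val: "h {p, q} = g (f (q - p))" if "p < q" for p q
    using that by (simp add: h_def)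
  have lt: "h {p, q} < s" if "p < q" for p q
  proof -
    have "f (q - p) \<in> f ` {0<..}" using that by simp
    then show ?thesis using g(1) val[OF that] by blast
  qed
  have "\<forall>p\<in>UNIV. \<forall>q\<in>UNIV. p \<noteq> q \<longrightarrow> h {p, q} < s"
    using lt by (metis insert_commute nat_neq_iff)
  from Ramsey2[OF infinite_UNIV_nat this] obtain Y t where
    Y: "infinite Y" "\<And>p q. p \<in> Y \<Longrightarrow> q \<in> Y \<Longrightarrow> p \<noteq> q \<Longrightarrow> h {p, q} = t"
    by metis
  obtain a where a: "a \<in> Y" using Y(1) by fastforce
  obtain b where b: "b \<in> Y" "b > a" using Y(1) infinite_nat_iff_unbounded by blast
  obtain c where c: "c \<in> Y" "c > b" using Y(1) infinite_nat_iff_unbounded by blast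
  have eq: "g (f (b - a)) = t" "g (f (c - b)) = t" "g (f (c - a)) = t"
    using Y(2) a b c val by (metis less_irrefl less_trans)+
  have sum: "(b - a) + (c - b) = c - a" using b c by simp
  show thesis
  proof (rule that[of "b - a" "c - b"])
    show "f (b - a) = f (c - b)" using eq b c by (intro inj_onD[OF g(2)]) auto
    show "f (b - a + (c - b)) = f (b - a)"
      unfolding sum using eq b c by (intro inj_onD[OF g(2)]) auto
  qed (use b c in auto)
qed

text \<open>Each new factor is replaced by an associate in \<open>R\<close>: the unit is absorbed
  into \<open>u\<close>, and one exponent grows by one.\<close>

lemma prod_mset_eq_unit_times_prod_powers:
  fixes R :: "'a::idom set"
  assumes R: "finite R" "\<And>p. irreducible p \<Longrightarrow> \<exists>u r. u dvd 1 \<and> r \<in> R \<and> p = u * r"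
    and P: "\<forall>p\<in>#P. irreducible p"
  shows "\<exists>u f. u dvd 1 \<and> prod_mset P = u * (\<Prod>r\<in>R. r ^ f r)"
  using P
proof (induction P)
  case empty
  have "prod_mset {#} = 1 * (\<Prod>r\<in>R. r ^ 0)" by simp
  then show ?case using one_dvd by (intro exI conjI)
next
  case (add p P)
  obtain u f where uf: "u dvd 1" "prod_mset P = u * (\<Prod>r\<in>R. r ^ f r)" using add by auto
  obtain v q where vq: "v dvd 1" "q \<in> R" "p = v * q" using R(2)[of p] add.prems by auto
  \<comment> \<open>The extra factor \<open>q\<close> is spread over the product as a term equal to
    1 away from \<open>q\<close>, so that \<open>prod.distrib\<close> can split it off.\<close>
  have "(\<Prod>r\<in>R. r ^ (if r = q then Suc (f r) else f r))
      = (\<Prod>r\<in>R. (if r = q then r else 1) * r ^ f r)"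
    by (intro prod.cong) auto
  also have "\<dots> = q * (\<Prod>r\<in>R. r ^ f r)"
    using R(1) vq(2) by (simp add: prod.distrib)
  finally have "prod_mset (add_mset p P)
      = (v * u) * (\<Prod>r\<in>R. r ^ (if r = q then Suc (f r) else f r))"
    using uf vq by (simp add: mult_ac)
  moreover have "v * u dvd 1" using mult_dvd_mono[OF vq(1) uf(1)] by simp
  ultimately show ?case by (intro exI conjI)
qed

text \<open>Division with remainder of each exponent by \<open>n\<close> puts the quotients into
  \<open>w\<close> and leaves remainders below \<open>n\<close> in \<open>c\<close>. That
  \<open>C\<close> avoids 0 allows \<open>c\<close> to be cancelled later.\<close>

lemma finite_power_classes:
  fixes n :: nat
  assumes atomic: "atomic_domain TYPE('a::idom)"
    and fin: "finite ({p::'a::idom. irreducible p} // irreducible_equiv)"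
    and n: "n > 0"
  shows "\<exists>C::'a::idom set. finite C \<and> 0 \<notin> C \<and>
    (\<forall>x. x \<noteq> 0 \<longrightarrow> (\<exists>u c w. u dvd 1 \<and> c \<in> C \<and> w \<noteq> 0 \<and> x = u * c * w ^ n))"
proof -
  \<comment> \<open>One representative is chosen from each class of irreducibles.\<close>
  define R :: "'a set" where
    "R = (\<lambda>K. SOME p. p \<in> K) ` ({p. irreducible p} // irreducible_equiv)"
  have finR: "finite R" unfolding R_def using fin by simp
  have R0: "r \<noteq> 0" if "r \<in> R" for r
  proof -
    obtain K where K: "K \<in> {p::'a. irreducible p} // irreducible_equiv" "r = (SOME p. p \<in> K)"
      using \<open>r \<in> R\<close> R_def by blast
    have "K \<noteq> {}" using K(1) in_quotient_imp_non_empty[OF equiv_irreducible_equiv] by blast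
    then have "r \<in> K" using K(2) by (simp add: some_in_eq)
    then show ?thesis using in_quotient_imp_subset[OF equiv_irreducible_equiv K(1)] by auto
  qed
  have R: "\<exists>u r. u dvd 1 \<and> r \<in> R \<and> p = u * r" if "irreducible p" for p :: 'a
  proof -
    define r where "r = (SOME q. q \<in> irreducible_equiv `` {p})"
    have "p \<in> irreducible_equiv `` {p}"
      using that equiv_class_self[OF equiv_irreducible_equiv] by simp
    then have "r \<in> irreducible_equiv `` {p}" unfolding r_def by (rule someI)
    then have "\<exists>u. u dvd 1 \<and> p = u * r"
      by (auto simp: irreducible_equiv_def unit_set_def)
    moreover have "r \<in> R" unfolding R_def r_def using that by (intro imageI quotientI) simp
    ultimately show ?thesis by blast
  qed
  \<comment> \<open>\<open>PiE\<close> fixes the value of \<open>e\<close> outside \<open>R\<close>,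
    so there are only finitely many exponent functions; hence the \<open>restrict\<close> in the
    witness for \<open>c\<close> below.\<close>
  define C where "C = (\<lambda>e. \<Prod>r\<in>R. r ^ e r) ` (PiE R (\<lambda>_. {..<n}))"
  show ?thesis
  proof (intro exI[of _ C] conjI allI impI)
    show "finite C" unfolding C_def using finR by (intro finite_imageI finite_PiE) auto
    show "0 \<notin> C" using finR R0 by (auto simp: C_def)
    fix x :: 'a assume x: "x \<noteq> 0"
    have "\<exists>u f. u dvd 1 \<and> x = u * (\<Prod>r\<in>R. r ^ f r)"
    proof (cases "x dvd 1")
      case True
      moreover have "x = x * (\<Prod>r\<in>R. r ^ 0)" by simp
      ultimately show ?thesis by (intro exI conjI)
    next
      case False
      then obtain P where "\<forall>p\<in>#P. irreducible p" "x = prod_mset P"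
        using atomic x by (auto simp: atomic_domain_def unit_set_def)
      then show ?thesis using prod_mset_eq_unit_times_prod_powers[OF finR R] by simp
    qed
    then obtain u f where uf: "u dvd 1" "x = u * (\<Prod>r\<in>R. r ^ f r)" by blast
    define c where "c = (\<Prod>r\<in>R. r ^ (f r mod n))"
    define w where "w = (\<Prod>r\<in>R. r ^ (f r div n))"
    have "(\<Prod>r\<in>R. r ^ f r) = (\<Prod>r\<in>R. r ^ (f r mod n) * (r ^ (f r div n)) ^ n)"
      by (intro prod.cong) (simp_all flip: power_add power_mult)
    also have "\<dots> = c * w ^ n"
      by (simp add: c_def w_def prod.distrib prod_power_distrib)
    finally have "x = u * c * w ^ n" using uf by (simp add: mult.assoc)
    moreover have "c \<in> C"
      unfolding C_def c_def
      by (rule image_eqI[of _ _ "restrict (\<lambda>r. f r mod n) R"]) (use n in auto)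
    moreover have "w \<noteq> 0" using finR R0 by (simp add: w_def)
    ultimately show "\<exists>u c w. u dvd 1 \<and> c \<in> C \<and> w \<noteq> 0 \<and> x = u * c * w ^ n"
      using uf(1) by blast
  qed
qed

theorem theorem3p1:
  assumes atomic: "atomic_domain TYPE('a::{idom, ring_char_0})"
    and no_sol: "\<exists>n::nat. n \<ge> 2 \<and>
      \<not> (\<exists>ux\<in>unit_set. \<exists>uy\<in>unit_set. \<exists>uz\<in>unit_set.
          \<exists>X\<in>UNIV - {0::'a}. \<exists>Y\<in>UNIV - {0}. \<exists>Z\<in>UNIV - {0}.
            ux * X ^ n + uy * Y ^ n = uz * Z ^ n)"
  shows "infinite ({p::'a. irreducible p} // irreducible_equiv)"
proof
  assume fin: "finite ({p::'a. irreducible p} // irreducible_equiv)"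
  obtain n :: nat where n: "n \<ge> 2" and
    no: "\<And>ux uy uz X Y Z :: 'a. \<lbrakk>ux dvd 1; uy dvd 1; uz dvd 1; X \<noteq> 0; Y \<noteq> 0; Z \<noteq> 0\<rbrakk>
      \<Longrightarrow> ux * X ^ n + uy * Y ^ n \<noteq> uz * Z ^ n"
    using no_sol by (auto simp: unit_set_def)
  have "n > 0" using n by simp
  obtain C :: "'a set" where
    C: "finite C" "0 \<notin> C" and
    dec: "\<And>x. x \<noteq> 0 \<Longrightarrow> \<exists>u c w. u dvd 1 \<and> c \<in> C \<and> w \<noteq> 0 \<and> x = u * c * w ^ n"
    using finite_power_classes[OF atomic fin \<open>n > 0\<close>] by (elim exE conjE) simp
  \<comment> \<open>Characteristic 0 enters here: \<open>of_nat k\<close> is nonzero for positive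
    \<open>k\<close>, so it has a decomposition.\<close>
  have "\<exists>u c w. u dvd 1 \<and> c \<in> C \<and> w \<noteq> 0 \<and> of_nat k = u * c * w ^ n" if "k > 0" for k
    using that by (intro dec) simp
  then obtain u c w where ucw: "\<And>k. k > 0 \<Longrightarrow>
      u k dvd 1 \<and> c k \<in> C \<and> w k \<noteq> 0 \<and> of_nat k = u k * c k * w k ^ n"
    by metis
  have "finite (c ` {0<..})" using C(1) ucw by (auto intro: finite_subset)
  then obtain x y where xy: "x > 0" "y > 0" "c x = c y" "c (x + y) = c x"
    by (rule Schur)
  have "of_nat x + of_nat y = (of_nat (x + y) :: 'a)" by simp
  then have "c x * (u x * w x ^ n + u y * w y ^ n) = c x * (u (x + y) * w (x + y) ^ n)"
    using ucw[of x] ucw[of y] ucw[of "x + y"] xy by (simp add: algebra_simps)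
  moreover have "c x \<noteq> 0" using C(2) ucw xy(1) by metis
  ultimately have "u x * w x ^ n + u y * w y ^ n = u (x + y) * w (x + y) ^ n" by simp
  then show False using no ucw xy by (meson add_pos_pos)
qed

end
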